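(* Let $a>0$ and let $x$ be real. (1) If $\gamma>0$, then for every integer $n\ge0$ $$\frac{n!\,\mathscr{C}_n(x;a,\gamma)}{(\gamma+1)_n}=\sum_{k=0}^{n}\binom{n}{k}\frac{\gamma(-1)^k}{\gamma+k}\,C_{n-k}(x;a)\,C_k(-x-1;-a).$$ (2) For every $\gamma\in\mathbb{C}\setminus\{0,-1,-2,\dots\}$ and all complex $t$ with $|t|<|a|$, $$\sum_{n=0}^{+\infty}\frac{\gamma}{\gamma+n}C_n(x;a)\frac{t^n}{n!}=\Phi_1\left[\gamma,-x;\gamma+1;\,\frac{t}{a},\,t\right].$$
   Context: For real $a\neq0$, the associated Charlier polynomials $\mathscr{C}_n(x;a,\gamma)$ are defined by $\mathscr{C}_{-1}=0$, $\mathscr{C}_0=1$ and, for $n\ge0$, $$a\,\mathscr{C}_{n+1}(x;a,\gamma)=(n+\gamma+a-x)\,\mathscr{C}_n(x;a,\gamma)-(n+\gamma)\,\mathscr{C}_{n-1}(x;a,\gamma).$$ The Charlier polynomials are $C_n(x;a)=\mathscr{C}_n(x;a,0)$ (this definition is also used with the negative parameter $-a$). Pochhammer symbol: $(b)_0=1$, $(b)_k=b(b+1)\cdots(b+k-1)$. Humbert's confluent hypergeometric function is $$\Phi_1[\alpha_1,\lambda;\alpha_2;X,Y]=\sum_{m,n\ge0}\frac{(\alpha_1)_{m+n}(\lambda)_m}{(\alpha_2)_{m+n}}\frac{X^m}{m!}\frac{Y^n}{n!},\qquad |X|<1,\ |Y|<\infty.$$ *)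

theory Defs
  imports "HOL-Analysis.Analysis"
begin

(* The case n = 1 is the recurrence at n = 0 with the convention C_{-1} = 0.
   The recurrence is solved for its leading term, so the function is
   meaningful only for a \<noteq> 0. *)
fun assoc_charlier :: "nat \<Rightarrow> real \<Rightarrow> real \<Rightarrow> real \<Rightarrow> real" where
  "assoc_charlier 0 x a \<gamma> = 1"
| "assoc_charlier (Suc 0) x a \<gamma> = (\<gamma> + a - x) / a"
| "assoc_charlier (Suc (Suc n)) x a \<gamma> =
     ((real (Suc n) + \<gamma> + a - x) * assoc_charlier (Suc n) x a \<gamma>
       - (real (Suc n) + \<gamma>) * assoc_charlier n x a \<gamma>) / a"

lemma assoc_charlier_recurrence:
  assumes "a \<noteq> 0"
  shows "a * assoc_charlier (Suc n) x a \<gamma> =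
    (real n + \<gamma> + a - x) * assoc_charlier n x a \<gamma>
      - (real n + \<gamma>) * (if n = 0 then 0 else assoc_charlier (n - 1) x a \<gamma>)"
  using assms by (cases n) simp_all

definition charlier :: "nat \<Rightarrow> real \<Rightarrow> real \<Rightarrow> real" where
  "charlier n x a = assoc_charlier n x a 0"

(* Humbert's Phi_1 [alpha1, lambda; alpha2; X, Y] as an unordered double sum;
   meaningful for norm X < 1 and alpha2 not a nonpositive integer. *)
definition humbert_Phi1 ::
  "complex \<Rightarrow> complex \<Rightarrow> complex \<Rightarrow> complex \<Rightarrow> complex \<Rightarrow> complex" where
  "humbert_Phi1 \<alpha>1 l \<alpha>2 X Y =
     (\<Sum>\<^sub>\<infinity>(m, n)\<in>UNIV.
        pochhammer \<alpha>1 (m + n) * pochhammer l m / pochhammer \<alpha>2 (m + n)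
          * (X ^ m / fact m) * (Y ^ n / fact n))"

end

theory Submission
  imports Defs
begin

text \<open>
  Let \<open>f\<close> and \<open>g\<close> be the exponential generating functions of \<open>C\<^sub>n(x;a)\<close> and of
  \<open>(-1)\<^sup>n C\<^sub>n(-x-1;-a)\<close>. Each solves a first-order linear equation, and these combine to
  \<open>(a - t) f g = a\<close>. If \<open>G\<close> solves \<open>t G' + \<gamma> G = \<gamma> g\<close>, its coefficients are those of \<open>g\<close>
  times \<open>\<gamma>/(\<gamma>+k)\<close>, and \<open>R = f G\<close> satisfies
  \<open>(a - t)(t R' + \<gamma> R) = t (a - x - t) R + \<gamma> a\<close>, which on coefficients is the recurrence of
  the associated polynomials divided by \<open>(\<gamma>+1)\<^sub>n\<close>. For the second part,
  \<open>(\<gamma>)\<^sub>N/(\<gamma>+1)\<^sub>N = \<gamma>/(\<gamma>+N)\<close> is bounded in \<open>N\<close>, so the double series converges absolutely and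
  can be summed along the diagonals \<open>m + n = N\<close>.
\<close>

unbundle no vec_syntax
unbundle fps_syntax

section \<open>Normalized form of the recurrence\<close>

text \<open>Multiplying by \<open>pochhammer (\<gamma> + 1) n\<close> restores the defining
  recurrence, since \<open>n + \<gamma>\<close> is its last factor. Used for coefficients of power
  series, also at \<gamma> = 0.\<close>

lemma assoc_charlier_unique:
  fixes r :: "nat \<Rightarrow> real"
  assumes "a \<noteq> 0" "r 0 = 1"
    and rec: "\<And>n. a * (real n + 1 + \<gamma>) * r (Suc n) =
      (real n + \<gamma> + a - x) * r n - (if n = 0 then 0 else r (n - 1))"
  shows "pochhammer (\<gamma> + 1) n * r n = assoc_charlier n x a \<gamma>"
proof (induction n rule: induct_nat_012)
  case 0
  show ?case using assms by simp
next
  case 1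
  show ?case using rec[of 0] assms by (simp add: field_simps)
next
  case (ge2 n)
  let ?p = "pochhammer (\<gamma> + 1)"
  have "a * (?p (Suc (Suc n)) * r (Suc (Suc n))) =
      ?p (Suc n) * (a * (real (Suc n) + 1 + \<gamma>) * r (Suc (Suc n)))"
    by (simp add: pochhammer_rec'[of _ "Suc n"] algebra_simps)
  also have "\<dots> = (real (Suc n) + \<gamma> + a - x) * (?p (Suc n) * r (Suc n))
      - (real (Suc n) + \<gamma>) * (?p n * r n)"
    unfolding rec[of "Suc n"] by (simp add: pochhammer_rec' algebra_simps)
  also have "\<dots> = a * assoc_charlier (Suc (Suc n)) x a \<gamma>"
    using ge2 assms(1) by simp
  finally show ?case using assms(1) by (metis mult_left_cancel)
qed

section \<open>Exponential generating functions and their product\<close>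

definition charlier_fps :: "real \<Rightarrow> real \<Rightarrow> real fps" where
  "charlier_fps x a = Abs_fps (\<lambda>n. charlier n x a / fact n)"

text \<open>The sign replaces t by -t, which turns the leading coefficient -a - t of the equation
  for parameter \<open>- a\<close> into a - t up to sign, as for
  \<open>charlier_fps\<close>.\<close>

definition charlier_refl_fps :: "real \<Rightarrow> real \<Rightarrow> real fps" where
  "charlier_refl_fps x a = Abs_fps (\<lambda>n. (-1) ^ n * charlier n (- x - 1) (- a) / fact n)"

lemma charlier_coeff_recurrence:
  assumes "a \<noteq> 0"
  shows "a * (real n + 1) * (charlier (Suc n) x a / fact (Suc n)) =
    (real n + a - x) * (charlier n x a / fact n)
      - (if n = 0 then 0 else charlier (n - 1) x a / fact (n - 1))"
proof -
  have "a * (real n + 1) * (charlier (Suc n) x a / fact (Suc n)) =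
      a * assoc_charlier (Suc n) x a 0 / fact n"
    by (simp add: charlier_def add.commute del: assoc_charlier.simps)
  also have "\<dots> = (real n + a - x) * (charlier n x a / fact n)
      - (if n = 0 then 0 else charlier (n - 1) x a / fact (n - 1))"
    unfolding assoc_charlier_recurrence[OF assms]
    by (cases n) (simp_all add: charlier_def diff_divide_distrib
        del: of_nat_Suc assoc_charlier.simps(3))
  finally show ?thesis .
qed

lemma charlier_fps_ode:
  assumes "a \<noteq> 0"
  shows "(fps_const a - fps_X) * fps_deriv (charlier_fps x a) =
    (fps_const (a - x) - fps_X) * charlier_fps x a"
proof (rule fps_ext)
  fix n
  have "a * (real n + 1) * charlier_fps x a $ Suc n = (real n + a - x) * charlier_fps x a $ n
      - (if n = 0 then 0 else charlier_fps x a $ (n - 1))"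
    using charlier_coeff_recurrence[OF assms, of n x]
    by (simp only: charlier_fps_def fps_nth_Abs_fps)
  then show "((fps_const a - fps_X) * fps_deriv (charlier_fps x a)) $ n =
      ((fps_const (a - x) - fps_X) * charlier_fps x a) $ n"
    by (cases n) (simp_all add: algebra_simps)
qed

lemma charlier_refl_fps_ode:
  assumes "a \<noteq> 0"
  shows "(fps_const a - fps_X) * fps_deriv (charlier_refl_fps x a) =
    (fps_const (x + 1 - a) + fps_X) * charlier_refl_fps x a"
proof (rule fps_ext)
  fix n
  define c where "c k = charlier k (- x - 1) (- a) / fact k" for k
  have g: "charlier_refl_fps x a $ k = (-1) ^ k * c k" for k
    by (simp add: charlier_refl_fps_def c_def)
  have "- a * (real n + 1) * c (Suc n) =
      (real n + - a - (- x - 1)) * c n - (if n = 0 then 0 else c (n - 1))"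
    unfolding c_def by (rule charlier_coeff_recurrence) (use assms in simp)
  \<comment> \<open>The neighbours \<open>c (Suc n)\<close> and \<open>c (n - 1)\<close> have
    opposite parity to \<open>n\<close>, so exactly their terms change sign.\<close>
  from arg_cong[OF this, of "\<lambda>y. (-1) ^ n * y"] have "a * (real n + 1) * charlier_refl_fps x a $ Suc n =
      (real n + x + 1 - a) * charlier_refl_fps x a $ n
        + (if n = 0 then 0 else charlier_refl_fps x a $ (n - 1))"
    unfolding g by (cases n) (simp_all add: algebra_simps)
  then show "((fps_const a - fps_X) * fps_deriv (charlier_refl_fps x a)) $ n =
      ((fps_const (x + 1 - a) + fps_X) * charlier_refl_fps x a) $ n"
    by (cases n) (simp_all add: algebra_simps)
qed

text \<open>Formally the factors are e^t (1 - t/a)^x and e^(-t) (1 - t/a)^(-x-1). Showing that the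
  left side has derivative zero avoids these real powers.\<close>

lemma charlier_fps_mult_refl:
  assumes "a \<noteq> 0"
  shows "(fps_const a - fps_X) * (charlier_fps x a * charlier_refl_fps x a) = fps_const a"
proof -
  let ?f = "charlier_fps x a" and ?g = "charlier_refl_fps x a" and ?l = "fps_const a - fps_X"
  have "fps_deriv (?l * (?f * ?g)) =
      (?l * fps_deriv ?f) * ?g + ?f * (?l * fps_deriv ?g) - ?f * ?g"
    by (simp add: algebra_simps)
  also have "\<dots> = (fps_const (a - x) + fps_const (x + 1 - a) - 1) * (?f * ?g)"
    unfolding charlier_fps_ode[OF assms] charlier_refl_fps_ode[OF assms]
    by (simp add: algebra_simps flip: fps_const_add fps_const_sub)
  \<comment> \<open>The shift to \<open>- x - 1\<close> supplies the 1 that cancels the derivative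
    of a - t.\<close>
  also have "fps_const (a - x) + fps_const (x + 1 - a) - 1 = (0 :: real fps)"
    by (simp flip: fps_const_1_eq_1)
  finally have "fps_deriv (?l * (?f * ?g)) = 0"
    by simp
  then have "?l * (?f * ?g) = fps_const ((?l * (?f * ?g)) $ 0)"
    by (simp only: fps_deriv_eq_0_iff)
  also have "(?l * (?f * ?g)) $ 0 = a"
    by (simp add: charlier_fps_def charlier_refl_fps_def charlier_def)
  finally show ?thesis .
qed

section \<open>The convolution formula\<close>

text \<open>Both sides equal n! times coefficient n of \<open>R\<close>: the left by the recurrence,
  the right by the Cauchy product.\<close>

lemma assoc_charlier_convolution:
  fixes a x \<gamma> :: real
  assumes a: "a \<noteq> 0" and \<gamma>: "\<gamma> \<notin> \<int>\<^sub>\<le>\<^sub>0"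
  shows "fact n * assoc_charlier n x a \<gamma> / pochhammer (\<gamma> + 1) n =
    (\<Sum>k=0..n. real (n choose k) * (\<gamma> * (-1) ^ k / (\<gamma> + real k))
       * charlier (n - k) x a * charlier k (- x - 1) (- a))"
proof -
  have nz: "\<gamma> + real k \<noteq> 0" for k
    using \<gamma> plus_of_nat_eq_0_imp by blast
  have \<gamma>0: "\<gamma> \<noteq> 0" using nz[of 0] by simp
  define f where "f = charlier_fps x a"
  define g where "g = charlier_refl_fps x a"
  \<comment> \<open>Formally \<gamma> t^(-\<gamma>) times the integral of s^(\<gamma>-1) g(s) from 0
    to t, defined coefficientwise to avoid fractional powers.\<close>
  define G where "G = Abs_fps (\<lambda>k. \<gamma> / (\<gamma> + real k) * g $ k)"
  define R where "R = f * G"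
  let ?l = "fps_const a - fps_X"
  have G: "fps_X * fps_deriv G = fps_const \<gamma> * g - fps_const \<gamma> * G"
    by (rule fps_ext) (use nz in \<open>simp add: fps_mult_fps_X_deriv_shift G_def field_simps\<close>)
  have "?l * (fps_X * fps_deriv R + fps_const \<gamma> * R) =
      fps_X * (?l * fps_deriv f) * G + ?l * f * (fps_X * fps_deriv G + fps_const \<gamma> * G)"
    by (simp add: R_def algebra_simps)
  also have "\<dots> = fps_X * (fps_const (a - x) - fps_X) * R + fps_const \<gamma> * (?l * (f * g))"
    unfolding G f_def charlier_fps_ode[OF a] by (simp add: R_def f_def algebra_simps)
  also have "?l * (f * g) = fps_const a"
    unfolding f_def g_def by (rule charlier_fps_mult_refl[OF a])
  finally have ode: "?l * (fps_X * fps_deriv R + fps_const \<gamma> * R) =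
      fps_X * (fps_const (a - x) - fps_X) * R + fps_const \<gamma> * fps_const a" .
  have "pochhammer (\<gamma> + 1) n * R $ n = assoc_charlier n x a \<gamma>"
  proof (rule assoc_charlier_unique[OF a])
    show "R $ 0 = 1"
      using \<gamma>0 by (simp add: R_def f_def G_def g_def charlier_fps_def charlier_refl_fps_def charlier_def)
  next
    fix m
    show "a * (real m + 1 + \<gamma>) * R $ Suc m =
        (real m + \<gamma> + a - x) * R $ m - (if m = 0 then 0 else R $ (m - 1))"
      \<comment> \<open>The constant \<gamma> a affects only coefficient 0, so it is absent at
        \<open>Suc m\<close>.\<close>
      using arg_cong[OF ode, of "\<lambda>h. h $ Suc m"]
      by (cases m) (simp_all add: algebra_simps mult.assoc[of fps_X])
  qed
  moreover have "pochhammer (\<gamma> + 1) n \<noteq> 0"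
    using nz by (auto simp: pochhammer_eq_0_iff eq_neg_iff_add_eq_0 add.assoc)
       (metis of_nat_Suc)
  ultimately have "fact n * assoc_charlier n x a \<gamma> / pochhammer (\<gamma> + 1) n = fact n * R $ n"
    by (simp add: field_simps)
  \<comment> \<open>Swapped so that the summation index k falls on \<open>G\<close>.\<close>
  also have "R = G * f" by (simp add: R_def)
  also have "fact n * (G * f) $ n = (\<Sum>k=0..n. fact n * (G $ k * f $ (n - k)))"
    by (simp add: fps_mult_nth sum_distrib_left)
  also have "\<dots> = (\<Sum>k=0..n. real (n choose k) * (\<gamma> * (-1) ^ k / (\<gamma> + real k))
       * charlier (n - k) x a * charlier k (- x - 1) (- a))"
    by (rule sum.cong) (auto simp: G_def f_def g_def charlier_fps_def charlier_refl_fps_def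
        binomial_fact field_simps)
  finally show ?thesis .
qed

section \<open>The Humbert series\<close>

text \<open>The Cauchy product of (1 - t/a)^x, here \<open>B\<close>, with e^t. It satisfies the
  normalized recurrence at \<gamma> = 0, where \<open>pochhammer (0 + 1) n\<close> is n!.\<close>

lemma charlier_eq_sum:
  assumes "a \<noteq> 0"
  shows "charlier n x a / fact n =
    (\<Sum>k\<le>n. pochhammer (- x) k / (a ^ k * fact k) / fact (n - k))"
proof -
  define B where "B = Abs_fps (\<lambda>k. pochhammer (- x) k / (a ^ k * fact k))"
  define H where "H = B * fps_exp 1"
  let ?l = "fps_const a - fps_X"
  have B: "?l * fps_deriv B = fps_const (- x) * B"
  proof (rule fps_ext)
    fix n
    show "(?l * fps_deriv B) $ n = (fps_const (- x) * B) $ n"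
      using assms by (cases n) (simp_all add: B_def pochhammer_rec' field_simps del: of_nat_Suc)
  qed
  have "?l * fps_deriv H = (?l * fps_deriv B) * fps_exp 1 + ?l * H"
    by (simp add: H_def algebra_simps)
  also have "\<dots> = (fps_const (- x) + ?l) * H"
    unfolding B H_def by (simp only: ring_distribs mult.assoc)
  finally have ode: "?l * fps_deriv H = (fps_const (- x) + ?l) * H" .
  have "pochhammer (0 + 1) n * H $ n = assoc_charlier n x a 0"
  proof (rule assoc_charlier_unique[OF assms])
    show "H $ 0 = 1" by (simp add: H_def B_def)
  next
    fix m
    show "a * (real m + 1 + 0) * H $ Suc m =
        (real m + 0 + a - x) * H $ m - (if m = 0 then 0 else H $ (m - 1))"
      using arg_cong[OF ode, of "\<lambda>h. h $ m"]
      by (cases m) (simp_all add: algebra_simps)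
  qed
  then have "charlier n x a / fact n = H $ n"
    by (simp add: charlier_def field_simps flip: pochhammer_fact)
  also have "\<dots> = (\<Sum>k\<le>n. pochhammer (- x) k / (a ^ k * fact k) / fact (n - k))"
    by (simp add: H_def B_def fps_mult_nth atLeast0AtMost)
  finally show ?thesis .
qed

text \<open>This is the binomial series of (1 - z)^(-b), whose radius of convergence is 1, or
  infinite when it terminates.\<close>

lemma pochhammer_binomial_series_abs_summable:
  fixes b z :: complex
  assumes "norm z < 1"
  shows "summable (\<lambda>m. norm (pochhammer b m * (z ^ m / fact m)))"
proof -
  have "summable (\<lambda>m. norm (((- b) gchoose m) * (- z) ^ m))"
    using assms by (intro abs_summable_in_conv_radius)
      (simp add: conv_radius_gchoose one_ereal_def split: if_splits)
  moreover have "((- b) gchoose m) * (- z) ^ m = pochhammer b m * (z ^ m / fact m)" for m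
  proof -
    have "((- b) gchoose m) * (- z) ^ m = pochhammer b m / fact m * ((-1) ^ m * (- z) ^ m)"
      by (simp add: gbinomial_pochhammer)
    then show ?thesis by (simp flip: power_mult_distrib)
  qed
  ultimately show ?thesis by simp
qed

text \<open>Both (\<gamma>)_n (\<gamma> + n) and \<gamma> (\<gamma> + 1)_n equal
  (\<gamma>)_(n+1).\<close>

lemma pochhammer_Suc_ratio:
  fixes \<gamma> :: "'a :: field_char_0"
  assumes "\<gamma> \<notin> \<int>\<^sub>\<le>\<^sub>0"
  shows "pochhammer \<gamma> n / pochhammer (\<gamma> + 1) n = \<gamma> / (\<gamma> + of_nat n)"
proof -
  have "\<gamma> + of_nat n \<noteq> 0"
    using assms plus_of_nat_eq_0_imp by blast
  moreover have "pochhammer (\<gamma> + 1) n \<noteq> 0"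
    using assms pochhammer_eq_0_imp_nonpos_Int plus_one_in_nonpos_Ints_imp by blast
  moreover have "pochhammer \<gamma> n * (\<gamma> + of_nat n) = \<gamma> * pochhammer (\<gamma> + 1) n"
    by (metis mult.commute pochhammer_rec pochhammer_rec')
  ultimately show ?thesis by (simp add: field_simps)
qed

lemma bounded_divide_add_of_nat:
  fixes \<gamma> :: complex
  obtains C where "\<And>n. norm (\<gamma> / (\<gamma> + of_nat n)) \<le> C"
proof -
  have "(\<lambda>n. \<gamma> / (\<gamma> + of_nat n)) \<longlonglongrightarrow> 0"
    by (intro tendsto_divide_0[OF tendsto_const] tendsto_add_filterlim_at_infinity[OF tendsto_const]
        tendsto_of_nat)
  then have "Bseq (\<lambda>n. \<gamma> / (\<gamma> + of_nat n))"
    by (intro convergent_imp_Bseq) (auto simp: convergent_def)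
  then show ?thesis using that by (auto simp: Bseq_def)
qed

lemma humbert_Phi1_charlier_sums:
  fixes \<gamma> t :: complex and a x :: real
  assumes \<gamma>: "\<gamma> \<notin> \<int>\<^sub>\<le>\<^sub>0" and a: "a \<noteq> 0" and t: "norm t < \<bar>a\<bar>"
  shows "(\<lambda>n. \<gamma> / (\<gamma> + of_nat n) * complex_of_real (charlier n x a) * (t ^ n / fact n)) sums
    humbert_Phi1 \<gamma> (complex_of_real (- x)) (\<gamma> + 1) (t / complex_of_real a) t"
proof -
  define z where "z = t / complex_of_real a"
  define A where "A m = pochhammer (complex_of_real (- x)) m * (z ^ m / fact m)" for m
  define E where "E n = t ^ n / fact n" for n
  \<comment> \<open>The Humbert term after simplifying the Pochhammer ratio, which depends only on
    \<open>m + n\<close>.\<close>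
  define u where "u = (\<lambda>(m, n). \<gamma> / (\<gamma> + of_nat (m + n)) * A m * E n)"
  have Phi: "humbert_Phi1 \<gamma> (complex_of_real (- x)) (\<gamma> + 1) z t = infsum u UNIV"
    unfolding humbert_Phi1_def u_def A_def E_def
    by (intro infsum_cong) (auto simp: pochhammer_Suc_ratio[OF \<gamma>, symmetric] mult_ac simp del: of_nat_add)
  have "norm z < 1"
    using a t by (simp add: z_def norm_divide)
  then have "summable (\<lambda>m. norm (A m))"
    unfolding A_def by (rule pochhammer_binomial_series_abs_summable)
  then have sA: "(\<lambda>m. norm (A m)) summable_on UNIV"
    by (rule summable_nonneg_imp_summable_on) simp
  have "summable (\<lambda>n. norm (E n))"
    using summable_norm_exp[of t] by (simp add: E_def scaleR_conv_of_real divide_inverse mult.commute)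
  then have sE: "(\<lambda>n. norm (E n)) summable_on UNIV"
    by (rule summable_nonneg_imp_summable_on) simp
  obtain C where C: "\<And>n. norm (\<gamma> / (\<gamma> + of_nat n)) \<le> C"
    using bounded_divide_add_of_nat by blast
  \<comment> \<open>Up to the factor \<open>C\<close>, this product of two absolutely convergent
    series dominates \<open>u\<close>.\<close>
  have "(\<lambda>(m, n). norm (A m) * norm (E n)) summable_on UNIV \<times> UNIV"
  proof (rule summable_on_SigmaI)
    show "((\<lambda>n. case (m, n) of (m, n) \<Rightarrow> norm (A m) * norm (E n)) has_sum
        norm (A m) * infsum (\<lambda>n. norm (E n)) UNIV) UNIV" for m
      using has_sum_cmult_right[OF has_sum_infsum[OF sE]] by simp
  qed (auto intro: summable_on_cmult_left sA)
  then have "(\<lambda>p. C * (case p of (m, n) \<Rightarrow> norm (A m) * norm (E n))) summable_on UNIV"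
    by (intro summable_on_cmult_right) simp
  then have "(\<lambda>p. norm (u p)) summable_on UNIV"
    by (rule Infinite_Sum.abs_summable_on_comparison_test')
      (auto simp: u_def norm_mult mult.assoc simp del: of_nat_add times_divide_eq_left
        intro!: mult_right_mono C)
  then have "(u has_sum infsum u UNIV) UNIV"
    using abs_summable_summable has_sum_infsum by blast
  \<comment> \<open>Here N = m + n; the truncated subtraction \<open>N - m\<close> is exact because
    m \<le> N.\<close>
  moreover have "bij_betw (\<lambda>(N, m). (m, N - m)) (SIGMA N:UNIV. {..N :: nat}) UNIV"
    by (rule bij_betw_byWitness[where f' = "\<lambda>(m, n). (m + n, m)"]) auto
  ultimately have "((\<lambda>p. u ((\<lambda>(N, m). (m, N - m)) p)) has_sum infsum u UNIV) (SIGMA N:UNIV. {..N})"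
    by (subst has_sum_reindex_bij_betw)
  then have "((\<lambda>N. \<Sum>m\<le>N. u (m, N - m)) has_sum infsum u UNIV) UNIV"
    by (rule has_sum_SigmaD) (auto intro: has_sum_finiteI)
  then have "(\<lambda>N. \<Sum>m\<le>N. u (m, N - m)) sums infsum u UNIV"
    by (rule has_sum_imp_sums)
  \<comment> \<open>On a diagonal \<gamma>/(\<gamma> + N) and t^N factor out, leaving the sum in
    \<open>charlier_eq_sum\<close>.\<close>
  moreover have "(\<Sum>m\<le>N. u (m, N - m)) =
      \<gamma> / (\<gamma> + of_nat N) * complex_of_real (charlier N x a) * (t ^ N / fact N)" for N
  proof -
    have "(\<Sum>m\<le>N. u (m, N - m)) = (\<Sum>m\<le>N. \<gamma> / (\<gamma> + of_nat N) * t ^ N *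
        complex_of_real (pochhammer (- x) m / (a ^ m * fact m) / fact (N - m)))"
    proof (rule sum.cong)
      fix m assume "m \<in> {..N}"
      then have "t ^ N = t ^ m * t ^ (N - m)" "m + (N - m) = N"
        by (simp_all flip: power_add)
      then show "u (m, N - m) = \<gamma> / (\<gamma> + of_nat N) * t ^ N *
          complex_of_real (pochhammer (- x) m / (a ^ m * fact m) / fact (N - m))"
        unfolding u_def A_def E_def z_def prod.case
        by (simp only: pochhammer_of_real of_real_divide of_real_mult of_real_power of_real_fact
            power_divide) (simp add: field_simps)
    qed simp
    also have "\<dots> = \<gamma> / (\<gamma> + of_nat N) * t ^ N * complex_of_real (charlier N x a / fact N)"
      unfolding charlier_eq_sum[OF a] by (simp only: of_real_sum sum_distrib_left)
    finally show ?thesis by simp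
  qed
  ultimately show ?thesis
    by (simp only: Phi flip: z_def)
qed

theorem corollary3p1:
  fixes a x :: real
  assumes "a > 0"
  shows
    "(\<forall>\<gamma>::real. \<gamma> > 0 \<longrightarrow> (\<forall>n::nat.
        fact n * assoc_charlier n x a \<gamma> / pochhammer (\<gamma> + 1) n =
        (\<Sum>k=0..n. real (n choose k) * (\<gamma> * (-1) ^ k / (\<gamma> + real k))
            * charlier (n - k) x a * charlier k (- x - 1) (- a))))
     \<and>
     (\<forall>\<gamma>::complex. \<gamma> \<notin> \<int>\<^sub>\<le>\<^sub>0 \<longrightarrow> (\<forall>t::complex. norm t < \<bar>a\<bar> \<longrightarrow>
        (\<lambda>n. \<gamma> / (\<gamma> + of_nat n) * complex_of_real (charlier n x a) * (t ^ n / fact n)) sums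
          humbert_Phi1 \<gamma> (complex_of_real (- x)) (\<gamma> + 1) (t / complex_of_real a) t))"
proof (intro conjI allI impI)
  fix \<gamma> :: real and n :: nat
  assume "\<gamma> > 0"
  then have "\<gamma> \<notin> \<int>\<^sub>\<le>\<^sub>0" by auto
  with assms show "fact n * assoc_charlier n x a \<gamma> / pochhammer (\<gamma> + 1) n =
        (\<Sum>k=0..n. real (n choose k) * (\<gamma> * (-1) ^ k / (\<gamma> + real k))
            * charlier (n - k) x a * charlier k (- x - 1) (- a))"
    by (intro assoc_charlier_convolution) auto
qed (rule humbert_Phi1_charlier_sums, use assms in simp_all)

end
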